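(* Let $\boldsymbol{P}\in\mathbb{R}^{[3,n]}$ be stochastic. Then $\mathcal{T}(\boldsymbol{P})$ is the best Lipschitz constant, with respect to the $1$-norm, of the quadratic map $f:\mathcal{S}_1\to\mathcal{S}_1$ given by $f(x)=\boldsymbol{P}xx$, that is, $$\mathcal{T}(\boldsymbol{P})=\sup_{\substack{x,y\in\mathcal{S}_1\\ x\ne y}}\frac{\|\boldsymbol{P}xx-\boldsymbol{P}yy\|_1}{\|x-y\|_1}.$$ Therefore, if $\mathcal{T}(\boldsymbol{P})<1$ then there exists a unique $x\in\mathcal{S}_1$ such that $\boldsymbol{P}xx=x$. Moreover (still when $\mathcal{T}(\boldsymbol{P})<1$), the higher-order power method $x_{t+1}=\boldsymbol{P}x_tx_t$, $t=0,1,2,\dots$, converges to $x$ for any $x_0\in\mathcal{S}_1$, and $$\|x_t-x\|_1\le\mathcal{T}(\boldsymbol{P})^t\,\|x_0-x\|_1.$$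
   Context: $\mathbb{R}^{[3,n]}$ is the set of real $n\times n\times n$ arrays $\boldsymbol{P}=(\boldsymbol{P}_{ijk})$, $n\ge 2$. $\boldsymbol{P}$ is called stochastic if $\boldsymbol{P}_{ijk}\ge 0$ for all $i,j,k$ and $\sum_{i=1}^n\boldsymbol{P}_{ijk}=1$ for all $j,k$. For $x,y\in\mathbb{R}^n$, $(\boldsymbol{P}xy)_i=\sum_{j,k}\boldsymbol{P}_{ijk}x_jy_k$. Let $\mathcal{S}_1=\{x\in\mathbb{R}^n: x\ge 0,\ \|x\|_1=1\}$ and $\mathcal{Z}_1=\{x\in\mathbb{R}^n:\sum_i x_i=0,\ \|x\|_1=1\}$. Definition: $\mathcal{T}(\boldsymbol{P})=\max_{x\in\mathcal{S}_1}\max_{y\in\mathcal{Z}_1}\|\boldsymbol{P}xy+\boldsymbol{P}yx\|_1$. *)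

theory Defs
  imports "HOL-Analysis.Analysis"
begin

definition norm1 :: "real ^ 'n \<Rightarrow> real" where
  "norm1 x = (\<Sum>i\<in>UNIV. \<bar>x $ i\<bar>)"

text \<open>
  A cubic array is an element of \<^typ>\<open>real ^ 'n ^ 'n ^ 'n\<close>; the entry with indices
  \<open>i, j, k\<close>, in this order, is \<open>P $ i $ j $ k\<close>.
\<close>

definition stochastic :: "real ^ 'n ^ 'n ^ 'n \<Rightarrow> bool" where
  "stochastic P \<longleftrightarrow>
     (\<forall>i j k. 0 \<le> P $ i $ j $ k) \<and> (\<forall>j k. (\<Sum>i\<in>UNIV. P $ i $ j $ k) = 1)"

definition tapply :: "real ^ 'n ^ 'n ^ 'n \<Rightarrow> real ^ 'n \<Rightarrow> real ^ 'n \<Rightarrow> real ^ 'n" where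
  "tapply P x y = (\<chi> i. \<Sum>j\<in>UNIV. \<Sum>k\<in>UNIV. P $ i $ j $ k * x $ j * y $ k)"

definition S1 :: "(real ^ 'n) set" where
  "S1 = {x. (\<forall>i. 0 \<le> x $ i) \<and> norm1 x = 1}"

definition Z1 :: "(real ^ 'n) set" where
  "Z1 = {x. (\<Sum>i\<in>UNIV. x $ i) = 0 \<and> norm1 x = 1}"

text \<open>
  The suprema are maxima when the dimension is at least 2; see \<open>ergodicity_coeff_max\<close> below.
  In dimension 1 the set \<^term>\<open>Z1\<close> is empty.
\<close>

definition ergodicity_coeff :: "real ^ 'n ^ 'n ^ 'n \<Rightarrow> real" where
  "ergodicity_coeff P = (SUP x\<in>S1. SUP y\<in>Z1. norm1 (tapply P x y + tapply P y x))"

lemma continuous_on_norm1 [continuous_intros]: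
  "continuous_on A f \<Longrightarrow> continuous_on A (\<lambda>x. norm1 (f x))"
  unfolding norm1_def by (intro continuous_intros)

lemma continuous_on_tapply [continuous_intros]:
  "continuous_on A f \<Longrightarrow> continuous_on A g \<Longrightarrow> continuous_on A (\<lambda>x. tapply P (f x) (g x))"
  unfolding tapply_def by (intro continuous_intros)

lemma bounded_norm1_eq_1: "bounded {x :: real ^ 'n. norm1 x = 1}"
proof -
  have "norm x \<le> norm1 x" for x :: "real ^ 'n"
    unfolding norm1_def by (rule norm_le_l1_cart)
  then show ?thesis unfolding bounded_iff by (metis (mono_tags) mem_Collect_eq)
qed

lemma compact_S1: "compact (S1 :: (real ^ 'n) set)"
proof -
  have "closed {x :: real ^ 'n. norm1 x = 1}"
    by (intro closed_Collect_eq continuous_intros)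
  moreover have "closed {x :: real ^ 'n. \<forall>i. 0 \<le> x $ i}"
    by (intro closed_Collect_all closed_Collect_le continuous_intros)
  ultimately have "closed (S1 :: (real ^ 'n) set)"
    unfolding S1_def Collect_conj_eq by (intro closed_Int)
  moreover have "bounded (S1 :: (real ^ 'n) set)"
    by (rule bounded_subset [OF bounded_norm1_eq_1]) (auto simp: S1_def)
  ultimately show ?thesis by (simp add: compact_eq_bounded_closed)
qed

lemma compact_Z1: "compact (Z1 :: (real ^ 'n) set)"
proof -
  have "closed {x :: real ^ 'n. norm1 x = 1}"
    by (intro closed_Collect_eq continuous_intros)
  moreover have "closed {x :: real ^ 'n. (\<Sum>i\<in>UNIV. x $ i) = 0}"
    by (intro closed_Collect_eq continuous_intros)
  ultimately have "closed (Z1 :: (real ^ 'n) set)"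
    unfolding Z1_def Collect_conj_eq by (intro closed_Int)
  moreover have "bounded (Z1 :: (real ^ 'n) set)"
    by (rule bounded_subset [OF bounded_norm1_eq_1]) (auto simp: Z1_def)
  ultimately show ?thesis by (simp add: compact_eq_bounded_closed)
qed

lemma S1_nonempty: "(S1 :: (real ^ 'n) set) \<noteq> {}"
proof -
  have "axis (undefined :: 'n) 1 \<in> S1"
    by (auto simp: S1_def norm1_def axis_def if_distrib [of abs] cong: if_cong)
  then show ?thesis by blast
qed

lemma Z1_nonempty:
  assumes "CARD('n) \<ge> 2"
  shows "(Z1 :: (real ^ 'n) set) \<noteq> {}"
proof -
  obtain a b :: 'n where ab: "a \<noteq> b"
  proof -
    have "\<not> is_singleton (UNIV :: 'n set)"
      using assms by (simp add: is_singleton_altdef)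
    then show ?thesis using that by (metis UNIV_I UNIV_not_empty is_singletonI')
  qed
  define z :: "real ^ 'n" where "z = (\<chi> i. (if i = a then 1/2 else 0) - (if i = b then 1/2 else 0))"
  have "\<bar>z $ i\<bar> = (if i = a then 1/2 else 0) + (if i = b then 1/2 else 0)" for i
    using ab by (simp add: z_def)
  then have "z \<in> Z1"
    by (simp add: Z1_def norm1_def sum.distrib) (simp add: z_def sum_subtractf)
  then show ?thesis by blast
qed

lemma ergodicity_coeff_max:
  fixes P :: "real ^ 'n ^ 'n ^ 'n"
  assumes "CARD('n) \<ge> 2"
  shows "\<exists>x\<in>S1. \<exists>y\<in>Z1. ergodicity_coeff P = norm1 (tapply P x y + tapply P y x)"
    and "\<lbrakk>x \<in> S1; y \<in> Z1\<rbrakk> \<Longrightarrow> norm1 (tapply P x y + tapply P y x) \<le> ergodicity_coeff P"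
proof -
  let ?F = "\<lambda>x y. norm1 (tapply P x y + tapply P y x)"
  have ne: "(S1 :: (real ^ 'n) set) \<noteq> {}" "(Z1 :: (real ^ 'n) set) \<noteq> {}"
    using S1_nonempty Z1_nonempty [OF assms] by auto
  have "continuous_on (S1 \<times> Z1) (\<lambda>p. ?F (fst p) (snd p))"
    by (intro continuous_intros)
  then obtain p where p: "p \<in> S1 \<times> Z1"
    and max: "\<forall>q\<in>S1 \<times> Z1. ?F (fst q) (snd q) \<le> ?F (fst p) (snd p)"
    using continuous_attains_sup [OF compact_Times [OF compact_S1 compact_Z1]] ne by blast
  define a b where "a = fst p" and "b = snd p"
  then have ab: "a \<in> S1" "b \<in> Z1" using p by auto
  have le: "?F x y \<le> ?F a b" if "x \<in> S1" "y \<in> Z1" for x y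
    using bspec [OF max, of "(x, y)"] that by (simp add: a_def b_def)
  have inner: "(SUP y\<in>Z1. ?F x y) \<le> ?F a b" if "x \<in> S1" for x
    using ne le that by (auto intro: cSUP_least)
  have "?F a b \<le> (SUP y\<in>Z1. ?F a y)"
    using ab le by (intro cSUP_upper bdd_aboveI2 [where M = "?F a b"]) auto
  also have "\<dots> \<le> ergodicity_coeff P"
    unfolding ergodicity_coeff_def
    using ab inner by (intro cSUP_upper bdd_aboveI2 [where M = "?F a b"]) auto
  finally have "?F a b \<le> ergodicity_coeff P" .
  moreover have "ergodicity_coeff P \<le> ?F a b"
    unfolding ergodicity_coeff_def using ne inner by (metis (no_types, lifting) cSUP_least)
  ultimately have eq: "ergodicity_coeff P = ?F a b" by simp
  show "\<exists>x\<in>S1. \<exists>y\<in>Z1. ergodicity_coeff P = ?F x y" using ab eq by blast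
  show "\<lbrakk>x \<in> S1; y \<in> Z1\<rbrakk> \<Longrightarrow> ?F x y \<le> ergodicity_coeff P" using le eq by simp
qed

end

(* The polarization identity Pxx - Pyy = Pmz + Pzm, with m = (x + y)/2 in S1 and
   z = x - y of sum zero, gives the bound by T(P). For sharpness at a in S1, b in Z1, the points
   x, y = (1 - s) a + 2 s b\<^sup>\<plusminus> of S1 have difference 2 s b and midpoint (1 - s) a + s |b|,
   which tends to a. If T(P) < 1, a minimizer over the compact set S1 of the 1-norm of Pxx - x
   must be a fixed point, since applying the map again would decrease that norm. *)

theory Submission
  imports Defs
begin

lemma norm1_nonneg: "0 \<le> norm1 x"
  by (simp add: norm1_def sum_nonneg)

lemma norm1_eq_0_iff: "norm1 x = 0 \<longleftrightarrow> x = 0"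
  by (simp add: norm1_def sum_nonneg_eq_0_iff vec_eq_iff)

lemma norm1_pos_iff: "0 < norm1 x \<longleftrightarrow> x \<noteq> 0"
  using norm1_nonneg [of x] norm1_eq_0_iff [of x] by linarith

lemma norm1_scaleR: "norm1 (c *\<^sub>R x) = \<bar>c\<bar> * norm1 x"
  by (simp add: norm1_def abs_mult sum_distrib_left)

lemma norm_le_norm1: "norm x \<le> norm1 x"
  unfolding norm1_def by (rule norm_le_l1_cart)

text \<open>On nonnegative vectors \<open>norm1\<close> is the coordinate sum, so \<open>S1\<close>
  is the standard simplex and membership becomes a linear condition.\<close>

lemma mem_S1_iff: "x \<in> S1 \<longleftrightarrow> (\<forall>i. 0 \<le> x $ i) \<and> (\<Sum>i\<in>UNIV. x $ i) = 1"
  by (auto simp: S1_def norm1_def)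

lemma convex_S1: "convex S1"
  by (auto simp: convex_def mem_S1_iff sum.distrib simp flip: sum_distrib_left)

lemma bilinear_tapply: "bilinear (tapply P)"
  unfolding bilinear_def
  by (auto intro!: linearI
      simp: tapply_def vec_eq_iff sum.distrib sum_distrib_left algebra_simps)

text \<open>After bilinear expansion the mixed terms \<open>tapply P x y\<close> and
  \<open>tapply P y x\<close> cancel between the two summands. Having both argument orders replaces
  any symmetry of \<open>P\<close> in its last two indices.\<close>

lemma tapply_diff_squares:
  "tapply P x x - tapply P y y =
    tapply P ((1/2) *\<^sub>R (x + y)) (x - y) + tapply P (x - y) ((1/2) *\<^sub>R (x + y))"
proof -
  note bl = bilinear_tapply [of P]
  have "tapply P ((1/2) *\<^sub>R (x + y)) (x - y) + tapply P (x - y) ((1/2) *\<^sub>R (x + y)) =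
    (1/2) *\<^sub>R (2 *\<^sub>R (tapply P x x - tapply P y y))"
    unfolding bilinear_lmul [OF bl] bilinear_rmul [OF bl] bilinear_ladd [OF bl] bilinear_radd [OF bl]
      bilinear_lsub [OF bl] bilinear_rsub [OF bl] scaleR_2
    by (simp add: algebra_simps)
  then show ?thesis by simp
qed

lemma tapply_mem_S1:
  assumes "stochastic P" "x \<in> S1" "y \<in> S1"
  shows "tapply P x y \<in> S1"
proof -
  \<comment> \<open>The sum over \<open>i\<close> is moved innermost, where stochasticity makes it
    1; what remains is the product of the masses of \<open>x\<close> and \<open>y\<close>.\<close>
  have "(\<Sum>i\<in>UNIV. tapply P x y $ i) = (\<Sum>j\<in>UNIV. \<Sum>i\<in>UNIV. \<Sum>k\<in>UNIV. P $ i $ j $ k * x $ j * y $ k)"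
    unfolding tapply_def vec_lambda_beta by (rule sum.swap)
  also have "\<dots> = (\<Sum>j\<in>UNIV. \<Sum>k\<in>UNIV. \<Sum>i\<in>UNIV. P $ i $ j $ k * x $ j * y $ k)"
    by (intro sum.cong refl sum.swap)
  also have "\<dots> = (\<Sum>j\<in>UNIV. \<Sum>k\<in>UNIV. (\<Sum>i\<in>UNIV. P $ i $ j $ k) * (x $ j * y $ k))"
    by (simp add: sum_distrib_right mult.assoc)
  also have "\<dots> = (\<Sum>j\<in>UNIV. x $ j) * (\<Sum>k\<in>UNIV. y $ k)"
    using assms(1) by (simp add: stochastic_def sum_product)
  finally show ?thesis
    using assms by (auto simp: mem_S1_iff stochastic_def tapply_def intro!: sum_nonneg)
qed

lemma norm1_tapply_diff_squares_le:
  fixes P :: "real ^ 'n ^ 'n ^ 'n"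
  assumes card: "CARD('n) \<ge> 2" and "x \<in> S1" "y \<in> S1"
  shows "norm1 (tapply P x x - tapply P y y) \<le> ergodicity_coeff P * norm1 (x - y)"
proof (cases "x = y")
  case True
  then show ?thesis by (simp add: norm1_def)
next
  case False
  \<comment> \<open>\<open>z\<close> is the difference scaled to \<open>norm1\<close> equal to 1, so
    that the pair \<open>m\<close>, \<open>z\<close> is admissible in the maximum defining the
    coefficient.\<close>
  define d m z where "d = norm1 (x - y)" and "m = (1/2) *\<^sub>R (x + y)" and "z = (1/d) *\<^sub>R (x - y)"
  have d: "d > 0" using False by (simp add: d_def norm1_pos_iff)
  have m: "m \<in> S1"
    using convexD [OF convex_S1 assms(2,3), of "1/2" "1/2"] by (simp add: m_def scaleR_add_right)
  have "(\<Sum>i\<in>UNIV. z $ i) = (1/d) * ((\<Sum>i\<in>UNIV. x $ i) - (\<Sum>i\<in>UNIV. y $ i))"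
    by (simp add: z_def sum_subtractf flip: sum_divide_distrib)
  also have "\<dots> = 0" using assms by (simp add: mem_S1_iff)
  finally have z: "z \<in> Z1" using d by (simp add: Z1_def z_def norm1_scaleR d_def)
  have xy: "x - y = d *\<^sub>R z" using d by (simp add: z_def)
  have "norm1 (tapply P x x - tapply P y y) = d * norm1 (tapply P m z + tapply P z m)"
    using d unfolding tapply_diff_squares m_def [symmetric] xy
    by (simp add: bilinear_lmul [OF bilinear_tapply] bilinear_rmul [OF bilinear_tapply] norm1_scaleR
        flip: scaleR_add_right)
  also have "\<dots> \<le> d * ergodicity_coeff P"
    using ergodicity_coeff_max(2) [OF card m z] d by simp
  finally show ?thesis by (simp add: d_def mult.commute)
qed

text \<open>This is the sharpness half: \<open>L\<close> is an arbitrary Lipschitz constant, later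
  taken to be the supremum of the quotients.\<close>

lemma ergodicity_coeff_le:
  fixes P :: "real ^ 'n ^ 'n ^ 'n"
  assumes card: "CARD('n) \<ge> 2"
    and L: "\<And>x y. \<lbrakk>x \<in> S1; y \<in> S1\<rbrakk> \<Longrightarrow>
      norm1 (tapply P x x - tapply P y y) \<le> L * norm1 (x - y)"
  shows "ergodicity_coeff P \<le> L"
proof -
  obtain a b where a: "a \<in> S1" and b: "b \<in> Z1"
    and ab: "ergodicity_coeff P = norm1 (tapply P a b + tapply P b a)"
    using ergodicity_coeff_max(1) [OF card] by blast
  \<comment> \<open>\<open>bp\<close> and \<open>bm\<close> are twice the positive and negative
    parts of \<open>b\<close>. Each part has mass 1/2, because \<open>b\<close> has sum 0 and
    \<open>norm1\<close> equal to 1. Their midpoint is \<open>c\<close>.\<close>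
  define bp bm c :: "real ^ 'n" where "bp = (\<chi> i. \<bar>b $ i\<bar> + b $ i)"
    and "bm = (\<chi> i. \<bar>b $ i\<bar> - b $ i)" and "c = (\<chi> i. \<bar>b $ i\<bar>)"
  have bp: "bp \<in> S1" and bm: "bm \<in> S1"
    using b by (auto simp: mem_S1_iff bp_def bm_def Z1_def norm1_def sum.distrib sum_subtractf)
  define w where "w s = (1 - s) *\<^sub>R a + s *\<^sub>R c" for s :: real
  \<comment> \<open>The maximizer \<open>a\<close> may lie on the boundary of the simplex, with no
    room to move along \<open>b\<close> and \<open>-b\<close>; mixing in \<open>c\<close> makes
    room. Positivity of \<open>s\<close> allows the final division by \<open>2 * s\<close>.\<close>
  have le: "norm1 (tapply P (w s) b + tapply P b (w s)) \<le> L" if s: "0 < s" "s < 1" for s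
  proof -
    define x y where "x = (1 - s) *\<^sub>R a + s *\<^sub>R bp" and "y = (1 - s) *\<^sub>R a + s *\<^sub>R bm"
    have "x \<in> S1" "y \<in> S1"
      unfolding x_def y_def using s a bp bm by (auto intro!: convexD [OF convex_S1])
    then have "norm1 (tapply P x x - tapply P y y) \<le> L * norm1 (x - y)" by (rule L)
    moreover have "x - y = (2 * s) *\<^sub>R b" and "(1/2) *\<^sub>R (x + y) = w s"
      by (simp_all add: x_def y_def w_def bp_def bm_def c_def vec_eq_iff field_simps)
    ultimately have "(2 * s) * norm1 (tapply P (w s) b + tapply P b (w s)) \<le> L * (2 * s * norm1 b)"
      using s unfolding tapply_diff_squares
      by (simp add: bilinear_lmul [OF bilinear_tapply] bilinear_rmul [OF bilinear_tapply] norm1_scaleR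
        flip: scaleR_add_right)
    then show ?thesis using s b by (simp add: Z1_def)
  qed
  \<comment> \<open>The bound is known only for small positive \<open>s\<close>, so it is carried to
    \<open>w 0 = a\<close> by a one-sided limit.\<close>
  have "continuous_on UNIV (\<lambda>s. norm1 (tapply P (w s) b + tapply P b (w s)))"
    unfolding w_def by (intro continuous_intros)
  then have "((\<lambda>s. norm1 (tapply P (w s) b + tapply P b (w s))) \<longlongrightarrow>
      norm1 (tapply P (w 0) b + tapply P b (w 0))) (at_right 0)"
    unfolding continuous_on_def by (blast intro: tendsto_within_subset)
  moreover have "\<forall>\<^sub>F s in at_right 0. norm1 (tapply P (w s) b + tapply P b (w s)) \<le> L"
    unfolding eventually_at_right_field using le by (intro exI [of _ 1]) auto
  ultimately have "norm1 (tapply P (w 0) b + tapply P b (w 0)) \<le> L"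
    by (intro tendsto_upperbound) auto
  then show ?thesis by (simp add: ab w_def)
qed

lemma ergodicity_coeff_nonneg:
  fixes P :: "real ^ 'n ^ 'n ^ 'n"
  assumes "CARD('n) \<ge> 2"
  shows "0 \<le> ergodicity_coeff P"
  using ergodicity_coeff_max(1) [OF assms, of P] norm1_nonneg by metis

theorem theorem6p1:
  fixes P :: "real ^ 'n ^ 'n ^ 'n"
  assumes "CARD('n) \<ge> 2"
    and "stochastic P"
  shows "(\<forall>x\<in>S1. tapply P x x \<in> S1) \<and>
    bdd_above {norm1 (tapply P x x - tapply P y y) / norm1 (x - y) |x y. x \<in> S1 \<and> y \<in> S1 \<and> x \<noteq> y} \<and>
    ergodicity_coeff P =
      Sup {norm1 (tapply P x x - tapply P y y) / norm1 (x - y) |x y. x \<in> S1 \<and> y \<in> S1 \<and> x \<noteq> y} \<and>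
    (ergodicity_coeff P < 1 \<longrightarrow>
      (\<exists>!x. x \<in> S1 \<and> tapply P x x = x) \<and>
      (\<forall>x. x \<in> S1 \<and> tapply P x x = x \<longrightarrow>
        (\<forall>X :: nat \<Rightarrow> real ^ 'n.
          X 0 \<in> S1 \<and> (\<forall>t. X (Suc t) = tapply P (X t) (X t)) \<longrightarrow>
            X \<longlonglongrightarrow> x \<and>
            (\<forall>t. norm1 (X t - x) \<le> ergodicity_coeff P ^ t * norm1 (X 0 - x)))))"
proof -
  note card = assms(1)
  define T where "T = ergodicity_coeff P"
  define f where "f x = tapply P x x" for x
  let ?R = "{norm1 (f x - f y) / norm1 (x - y) |x y. x \<in> S1 \<and> y \<in> S1 \<and> x \<noteq> y}"
  have T: "0 \<le> T" using ergodicity_coeff_nonneg [OF card] by (simp add: T_def)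
  have maps: "f x \<in> S1" if "x \<in> S1" for x
    using tapply_mem_S1 [OF assms(2) that that] by (simp add: f_def)
  have lip: "norm1 (f x - f y) \<le> T * norm1 (x - y)" if "x \<in> S1" "y \<in> S1" for x y
    using norm1_tapply_diff_squares_le [OF card that] by (simp add: f_def T_def)
  have up: "r \<le> T" if "r \<in> ?R" for r
    using that lip by (force simp: divide_le_eq norm1_pos_iff)
  have bdd: "bdd_above ?R" using up by (rule bdd_aboveI)
  have "T \<le> Sup ?R"
    unfolding T_def
  proof (rule ergodicity_coeff_le [OF card])
    fix x y :: "real ^ 'n" assume xy: "x \<in> S1" "y \<in> S1"
    show "norm1 (tapply P x x - tapply P y y) \<le> Sup ?R * norm1 (x - y)"
    proof (cases "x = y")
      case True
      then show ?thesis by (simp add: norm1_def)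
    next
      case False
      then have "norm1 (f x - f y) / norm1 (x - y) \<le> Sup ?R"
        using xy by (intro cSup_upper [OF _ bdd]) blast
      then show ?thesis using False by (simp add: divide_le_eq norm1_pos_iff f_def)
    qed
  qed
  moreover have "Sup ?R \<le> T"
  proof (rule cSup_least [OF _ up])
    \<comment> \<open>Two distinct vertices of the simplex provide a quotient, so the supremum is
      over a nonempty set.\<close>
    obtain i j :: 'n where "i \<noteq> j"
      using card card_le_Suc0_iff_eq [of "UNIV :: 'n set"] by auto
    then have "axis i 1 \<noteq> (axis j 1 :: real ^ 'n)" by (simp add: axis_eq_axis)
    moreover have "axis k 1 \<in> S1" for k :: 'n by (auto simp: mem_S1_iff axis_def)
    ultimately show "?R \<noteq> {}" by blast
  qed
  ultimately have sup: "T = Sup ?R" by simp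
  have fixpoint: "\<exists>!x. x \<in> S1 \<and> f x = x" if T1: "T < 1"
  proof -
    have "continuous_on S1 (\<lambda>x. norm1 (f x - x))"
      unfolding f_def by (intro continuous_intros)
    then obtain x where x: "x \<in> S1" and min: "\<And>y. y \<in> S1 \<Longrightarrow> norm1 (f x - x) \<le> norm1 (f y - y)"
      using continuous_attains_inf [OF compact_S1 S1_nonempty] by blast
    \<comment> \<open>Minimality is tested against the competitor \<open>f x\<close>, whose residual
      \<open>f (f x) - f x\<close> is controlled by the Lipschitz bound. With \<open>T < 1\<close>
      the minimum must be 0.\<close>
    have "norm1 (f x - x) \<le> T * norm1 (f x - x)"
      using min [OF maps [OF x]] lip [OF maps [OF x] x] by linarith
    then have "f x = x" using T1 norm1_pos_iff [of "f x - x"] by force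
    moreover have "y = x" if "y \<in> S1" "f y = y" for y
    proof -
      have "norm1 (y - x) \<le> T * norm1 (y - x)"
        using lip [OF that(1) x] that(2) \<open>f x = x\<close> by simp
      then show ?thesis using T1 norm1_pos_iff [of "y - x"] by force
    qed
    ultimately show ?thesis using x by blast
  qed
  have power: "X \<longlonglongrightarrow> x \<and> (\<forall>t. norm1 (X t - x) \<le> T ^ t * norm1 (X 0 - x))"
    if T1: "T < 1" and x: "x \<in> S1" "f x = x" and X: "X 0 \<in> S1" "\<And>t. X (Suc t) = f (X t)"
    for x :: "real ^ 'n" and X :: "nat \<Rightarrow> real ^ 'n"
  proof -
    have mem: "X t \<in> S1" for t by (induction t) (simp_all add: X maps)
    have bound: "norm1 (X t - x) \<le> T ^ t * norm1 (X 0 - x)" for t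
    proof (induction t)
      case (Suc t)
      have "norm1 (X (Suc t) - x) \<le> T * norm1 (X t - x)"
        using lip [OF mem x(1)] by (simp add: X x(2))
      also have "\<dots> \<le> T * (T ^ t * norm1 (X 0 - x))" using Suc T by (rule mult_left_mono)
      finally show ?case by (simp add: mult.assoc)
    qed simp
    \<comment> \<open>Convergence of vectors is meant in the Euclidean norm, which
      \<open>norm1\<close> dominates, so this geometric bound suffices.\<close>
    have "(\<lambda>t. T ^ t * norm1 (X 0 - x)) \<longlonglongrightarrow> 0"
      using T T1 by (intro tendsto_mult_left_zero LIMSEQ_power_zero) simp
    then have "(\<lambda>t. X t - x) \<longlonglongrightarrow> 0"
      by (rule Lim_null_comparison [rotated]) (intro always_eventually allI order_trans [OF norm_le_norm1 bound])
    then show ?thesis using bound by (simp flip: Lim_null)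
  qed
  show ?thesis
    using maps bdd sup fixpoint power unfolding f_def T_def by (intro conjI impI) auto
qed

end
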